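(* Fix an integer $N>0$ and real powers $n_0 < \cdots < n_{N-1} < M$ (possibly negative). Also fix real scalars $\rho > 0$ and $c_{n_0}, \dots, c_{n_{N-1}}, c'$, and define $$f(x) := \sum_{j=0}^{N-1} c_{n_j} x^{n_j} + c' x^M .$$ Then the following are equivalent: (1) The entrywise map $f[-]$ preserves positivity on rank-one matrices in $\mathbb{P}_N((0,\rho))$. (2) Either all $c_{n_j}, c' \geqslant 0$; or $c_{n_j} > 0$ for all $j$ and $c' \geqslant -\mathcal{C}^{-1}$, where $$\mathcal{C} = \sum_{j=0}^{N-1} \frac{V(\mathbf{n}_j)^2}{V(\mathbf{n})^2} \frac{\rho^{M - n_j}}{c_{n_j}}.$$ Here $\mathbf{n} := (n_0, \dots, n_{N-1})$ and $\mathbf{n}_j := (n_0, \dots, n_{j-1}, n_{j+1}, \dots, n_{N-1}, M)$.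
   Context: For $I \subset \mathbb{C}$, $\mathbb{P}_N(I)$ denotes the set of positive semidefinite Hermitian $N\times N$ matrices all of whose entries lie in $I$. For a function $f$ on $I$ and $A=(a_{jk})$ with entries in $I$, $f[A] := (f(a_{jk}))$ is the entrywise application. The map $f[-]$ preserves positivity on a set of matrices in $\mathbb{P}_N(I)$ if $f[A]$ is positive semidefinite for every $A$ in that set. For a tuple $(t_0,\dots,t_{k-1})$, its Vandermonde determinant is $V(t_0,\dots,t_{k-1}) := \prod_{0 \leqslant i < j \leqslant k-1} (t_j - t_i)$ (an empty product is $1$). *)

theory Defs
  imports Complex_Main
    "Jordan_Normal_Form.Schur_Decomposition"
    "Jordan_Normal_Form.DL_Rank"
begin

text \<open>The definitions below make sense over any ordered field with conjugation. For the type of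
  complex numbers they give Hermitian positive semidefinite matrices; for the type of real numbers,
  where conjugation is the identity, they give real symmetric ones. The latter instance is used when
  the matrix entries are confined to a real interval.\<close>

definition pos_semidef :: "nat \<Rightarrow> 'a :: conjugatable_ordered_field mat \<Rightarrow> bool" where
  "pos_semidef N A \<longleftrightarrow> A \<in> carrier_mat N N \<and> mat_adjoint A = A \<and>
     (\<forall>v \<in> carrier_vec N. 0 \<le> (A *\<^sub>v v) \<bullet>c v)"

definition psd_mats :: "nat \<Rightarrow> 'a :: conjugatable_ordered_field set \<Rightarrow> 'a mat set" where
  "psd_mats N I = {A. pos_semidef N A \<and> elements_mat A \<subseteq> I}"

definition preserves_positivity_on ::
  "nat \<Rightarrow> ('a \<Rightarrow> 'a) \<Rightarrow> 'a :: conjugatable_ordered_field mat set \<Rightarrow> bool" where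
  "preserves_positivity_on N f S \<longleftrightarrow> (\<forall>A \<in> S. pos_semidef N (map_mat f A))"

abbreviation mat_rank :: "nat \<Rightarrow> 'a :: field mat \<Rightarrow> nat" where
  "mat_rank N \<equiv> vec_space.rank N"

definition vandermonde :: "'a :: comm_ring_1 list \<Rightarrow> 'a" where
  "vandermonde ts = (\<Prod>j<length ts. \<Prod>i<j. ts ! j - ts ! i)"

definition exponents :: "nat \<Rightarrow> (nat \<Rightarrow> real) \<Rightarrow> real list" where
  "exponents N n = map n [0..<N]"

definition exponents_omit :: "nat \<Rightarrow> (nat \<Rightarrow> real) \<Rightarrow> real \<Rightarrow> nat \<Rightarrow> real list" where
  "exponents_omit N n M j = map n [0..<j] @ map n [Suc j..<N] @ [M]"

definition threshold :: "nat \<Rightarrow> (nat \<Rightarrow> real) \<Rightarrow> real \<Rightarrow> real \<Rightarrow> (nat \<Rightarrow> real) \<Rightarrow> real" where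
  "threshold N n M \<rho> c =
     (\<Sum>j<N. vandermonde (exponents_omit N n M j) ^ 2 / vandermonde (exponents N n) ^ 2
             * (\<rho> powr (M - n j) / c j))"

end

theory Submission
  imports Defs "Jordan_Normal_Form.DL_Rank_Submatrix" "HOL-Analysis.Convex"
begin

text \<open>
  A rank-one matrix in \<open>\<P>\<^sub>N((0,\<rho>))\<close> is \<open>u u\<^sup>T\<close> for a vector \<open>u\<close> with entries in
  \<open>(0, \<surd>\<rho>)\<close>, and the quadratic form of \<open>f[u u\<^sup>T]\<close> at \<open>v\<close> is
  \<open>(\<Sum>j. c\<^sub>j s\<^sub>j\<^sup>2) + c' w\<^sup>2\<close>, where \<open>s\<^sub>j = \<Sum>i. v\<^sub>i u\<^sub>i powr n\<^sub>j\<close> and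
  \<open>w = \<Sum>i. v\<^sub>i u\<^sub>i powr M\<close>. If \<open>x powr M\<close> agrees with \<open>\<Sum>j. a\<^sub>j x powr n\<^sub>j\<close> at all entries
  of \<open>u\<close>, then \<open>w = \<Sum>j. a\<^sub>j s\<^sub>j\<close>, so the sign of the form depends on the sizes of the
  interpolation coefficients \<open>a\<^sub>j\<close>.

  Sufficiency. If all \<open>c\<^sub>j\<close> and \<open>c'\<close> are nonnegative, the form is a nonnegative combination of
  squares. In the other case the coefficients are controlled by
  \<open>\<bar>a\<^sub>j\<bar> \<le> \<bar>L\<^sub>j(M)\<bar> (\<surd>\<rho>) powr (M - n\<^sub>j)\<close>, where \<open>L\<^sub>j\<close> is the Lagrange basis polynomial of the
  nodes \<open>n\<^sub>0, \<dots>, n\<^bsub>N-1\<^esub>\<close>; this is what \<open>\<bar>a\<^sub>j\<bar>\<close> approaches when all nodes \<open>u\<^sub>i\<close> merge at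
  \<open>\<surd>\<rho>\<close>. After the substitution \<open>u = \<surd>\<rho> e\<^sup>x\<close>, the error of the interpolation is an
  exponential sum with \<open>N + 1\<close> terms and \<open>N\<close> zeros \<open>x \<le> 0\<close>. Multiplying it by
  \<open>exp (- n\<^sub>k x)\<close> and differentiating removes the term of index \<open>k\<close>, costs one zero by Rolle's
  theorem, and changes the other coefficients by exactly the factors that distinguish the bounds
  for \<open>N\<close> and \<open>N - 1\<close> terms (\<open>exp_sum_coeff_bound\<close>). Since
  \<open>L\<^sub>j(M)\<^sup>2\<close> is the squared Vandermonde ratio in the threshold \<open>\<C>\<close>
  (\<open>vandermonde_ratio_squared\<close>), the Cauchy-Schwarz inequality gives
  \<open>w\<^sup>2 \<le> \<C> (\<Sum>j. c\<^sub>j s\<^sub>j\<^sup>2)\<close>.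

  Necessity. At geometric nodes \<open>u\<^sub>i = r q\<^sup>i\<close> the powers \<open>u\<^sub>i powr n\<^sub>j\<close> form, up to scaling, an
  ordinary Vandermonde matrix in the numbers \<open>q powr n\<^sub>j\<close>, so Lagrange interpolation by polynomials
  provides a vector \<open>v\<close> with any prescribed \<open>s\<^sub>j\<close> and makes the \<open>a\<^sub>j\<close> explicit
  (\<open>geometric_nodes_interpolation\<close>). Isolating one \<open>s\<^sub>j\<close> and letting \<open>r\<close> tend to 0 yields the
  signs of the \<open>c\<^sub>j\<close>. Choosing \<open>s\<^sub>j = a\<^sub>j / c\<^sub>j\<close>, which is the equality case of
  Cauchy-Schwarz, and letting the nodes merge at \<open>\<surd>\<rho>\<close> yields the bound on \<open>c'\<close>.
\<close>

section \<open>Values of Lagrange basis polynomials\<close>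

definition lagrange_basis :: "'i set \<Rightarrow> ('i \<Rightarrow> real) \<Rightarrow> real \<Rightarrow> 'i \<Rightarrow> real" where
  "lagrange_basis J e x j = (\<Prod>i\<in>J - {j}. (x - e i) / (e j - e i))"

lemma lagrange_basis_at_node:
  assumes "finite J" "inj_on e J" "j \<in> J" "k \<in> J"
  shows "lagrange_basis J e (e k) j = (if j = k then 1 else 0)"
proof (cases "j = k")
  case True
  have "(e k - e i) / (e k - e i) = 1" if "i \<in> J - {k}" for i
    using assms that by (auto dest: inj_onD)
  then show ?thesis using True by (simp add: lagrange_basis_def)
next
  case False
  then show ?thesis using assms by (auto simp: lagrange_basis_def)
qed

lemma lagrange_basis_nonzero:
  assumes "finite J" "inj_on e J" "j \<in> J" "x \<notin> e ` (J - {j})"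
  shows "lagrange_basis J e x j \<noteq> 0"
  using assms by (auto simp: lagrange_basis_def dest: inj_onD)

section \<open>Coefficients of exponential sums with many zeros\<close>

text \<open>Rolle's theorem between consecutive points of \<open>X\<close>. The zeros found stay below elements of
  \<open>X\<close>, so every upper bound of the zeros of \<open>h\<close> is inherited by those of \<open>h'\<close>.\<close>

lemma zeros_of_derivative:
  fixes h h' :: "real \<Rightarrow> real"
  assumes der: "\<And>x. (h has_real_derivative h' x) (at x)"
    and "finite X" and "\<And>x. x \<in> X \<Longrightarrow> h x = 0"
  shows "\<exists>Y. finite Y \<and> card Y = card X - 1 \<and> (\<forall>y\<in>Y. h' y = 0 \<and> (\<exists>x\<in>X. y \<le> x))"
  using assms(2,3)
proof (induction X rule: finite_linorder_max_induct)
  case empty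
  then show ?case by (intro exI[of _ "{}"]) auto
next
  case (insert b A)
  then obtain Y where Y: "finite Y" "card Y = card A - 1"
    "\<forall>y\<in>Y. h' y = 0 \<and> (\<exists>x\<in>A. y \<le> x)" by auto
  show ?case
  proof (cases "A = {}")
    case True
    then show ?thesis by (intro exI[of _ "{}"]) auto
  next
    case False
    define a where "a = Max A"
    have a: "a \<in> A" "a < b" "\<And>x. x \<in> A \<Longrightarrow> x \<le> a"
      using insert.hyps False by (auto simp: a_def)
    have cont: "continuous_on {a..b} h"
      by (intro continuous_at_imp_continuous_on ballI DERIV_isCont[OF der])
    have eq: "h a = h b" using insert.prems a(1) by simp
    have dif: "\<And>x. h differentiable (at x)"
      using der real_differentiable_def by blast
    obtain z where z: "a < z" "z < b" "DERIV h z :> 0"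
      using Rolle[OF a(2) eq cont dif] by blast
    have hz: "h' z = 0" using DERIV_unique[OF der z(3)] .
    have "z \<notin> Y" using Y(3) a(3) z(1) by force
    moreover have "card A \<ge> 1" using False insert.hyps(1) by (simp add: Suc_le_eq card_gt_0_iff)
    moreover have "b \<notin> A" using insert.hyps by auto
    ultimately show ?thesis
      using Y hz z insert.hyps
      by (intro exI[of _ "insert z Y"]) auto
  qed
qed

text \<open>Induction on the number of terms. To bound the coefficient of index \<open>j\<close>, some other term \<open>k\<close> is
  removed by differentiating the sum times \<open>exp (- e k * x)\<close>. This multiplies \<open>\<alpha> j\<close> by
  \<open>e j - e k\<close> and \<open>\<beta>\<close> by \<open>M - e k\<close>, and the quotient of these is precisely the factor of the
  Lagrange product that is missing in the bound for \<open>J - {k}\<close>. The condition \<open>x \<le> 0\<close> is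
  inherited by the new zeros, and once a single term is left it gives
  \<open>exp ((M - e j) * x) \<le> 1\<close>.\<close>

lemma exp_sum_coeff_bound:
  fixes e \<alpha> :: "'i \<Rightarrow> real"
  assumes "finite J" "inj_on e J" "\<And>i. i \<in> J \<Longrightarrow> e i < M"
    and "finite X" "card X = card J" "\<And>x. x \<in> X \<Longrightarrow> x \<le> 0"
    and "\<And>x. x \<in> X \<Longrightarrow> (\<Sum>i\<in>J. \<alpha> i * exp (e i * x)) + \<beta> * exp (M * x) = 0"
    and "j \<in> J"
  shows "\<bar>\<alpha> j\<bar> \<le> \<bar>\<beta>\<bar> * \<bar>lagrange_basis J e M j\<bar>"
  using assms
proof (induction "card J" arbitrary: J \<alpha> \<beta> X)
  case 0
  then show ?case by simp
next
  case (Suc m)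
  show ?case
  proof (cases "J = {j}")
    case True
    then have "card X = 1" using Suc.prems by simp
    then obtain x where x: "X = {x}" by (auto simp: card_Suc_eq)
    have "\<alpha> j * exp (e j * x) + \<beta> * exp (M * x) = 0"
      using Suc.prems(7)[of x] x True by simp
    moreover have "exp (M * x) = exp (e j * x) * exp ((M - e j) * x)"
      by (simp add: exp_add[symmetric] algebra_simps)
    ultimately have "exp (e j * x) * (\<alpha> j + \<beta> * exp ((M - e j) * x)) = 0"
      by (simp add: algebra_simps)
    then have "\<alpha> j = - \<beta> * exp ((M - e j) * x)" by simp
    then have "\<bar>\<alpha> j\<bar> = \<bar>\<beta>\<bar> * exp ((M - e j) * x)" by (simp add: abs_mult)
    also have "\<dots> \<le> \<bar>\<beta>\<bar> * 1"
      using Suc.prems(3)[of j] Suc.prems(6)[of x] x True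
      by (intro mult_left_mono) (auto intro: mult_nonneg_nonpos)
    finally show ?thesis using True by (simp add: lagrange_basis_def)
  next
    case False
    then obtain k where k: "k \<in> J" "k \<noteq> j" using Suc.prems(8) by blast
    define J' where "J' = J - {k}"
    have J': "finite J'" "J = insert k J'" "k \<notin> J'" "j \<in> J'" "card J' = m"
      using k Suc.prems Suc.hyps(2) by (auto simp: J'_def)
    define h where "h = (\<lambda>x. (\<Sum>i\<in>J. \<alpha> i * exp ((e i - e k) * x)) + \<beta> * exp ((M - e k) * x))"
    define h' where "h' = (\<lambda>x. (\<Sum>i\<in>J. \<alpha> i * (exp ((e i - e k) * x) * (e i - e k)))
        + \<beta> * (exp ((M - e k) * x) * (M - e k)))"
    have der: "(h has_real_derivative h' x) (at x)" for x
      unfolding h_def h'_def by (auto intro!: derivative_eq_intros sum.cong)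
    have shift: "exp ((p - e k) * x) = exp (- (e k * x)) * exp (p * x)" for p x
      by (simp add: exp_add[symmetric] left_diff_distrib)
    have h_eq: "h x = exp (- (e k * x)) * ((\<Sum>i\<in>J. \<alpha> i * exp (e i * x)) + \<beta> * exp (M * x))" for x
      unfolding h_def shift by (simp add: sum_distrib_left distrib_left mult.left_commute)
    have "h x = 0" if "x \<in> X" for x
      using Suc.prems(7)[OF that] by (simp add: h_eq)
    then obtain Y where Y: "finite Y" "card Y = card X - 1"
      "\<forall>y\<in>Y. h' y = 0 \<and> (\<exists>x\<in>X. y \<le> x)"
      using zeros_of_derivative[OF der Suc.prems(4)] by blast
    define \<alpha>' where "\<alpha>' i = \<alpha> i * (e i - e k)" for i
    define \<beta>' where "\<beta>' = \<beta> * (M - e k)"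
    have h'_eq: "h' y = exp (- (e k * y)) * ((\<Sum>i\<in>J'. \<alpha>' i * exp (e i * y)) + \<beta>' * exp (M * y))" for y
      unfolding h'_def shift J'(2) using J'(1,3)
      by (simp add: \<alpha>'_def \<beta>'_def sum_distrib_left distrib_left mult_ac)
    have "\<bar>\<alpha>' j\<bar> \<le> \<bar>\<beta>'\<bar> * \<bar>lagrange_basis J' e M j\<bar>"
    proof (rule Suc.hyps(1))
      show "m = card J'" "finite J'" "j \<in> J'" "finite Y" using J' Y by auto
      show "inj_on e J'" using Suc.prems(2) by (auto simp: J'_def intro: inj_on_subset)
      show "card Y = card J'" using Y(2) Suc.prems(5) Suc.hyps(2) J'(5) by simp
      show "e i < M" if "i \<in> J'" for i using that Suc.prems(3) by (auto simp: J'_def)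
      show "y \<le> 0" if "y \<in> Y" for y using that Y(3) Suc.prems(6) by force
      show "(\<Sum>i\<in>J'. \<alpha>' i * exp (e i * y)) + \<beta>' * exp (M * y) = 0" if "y \<in> Y" for y
        using Y(3) that h'_eq[of y] by simp
    qed
    moreover have ne: "e j \<noteq> e k" using Suc.prems(2,8) k by (auto dest: inj_onD)
    moreover have J'_diff: "J - {j} - {k} = J' - {j}" by (auto simp: J'_def)
    then have "lagrange_basis J e M j = (M - e k) / (e j - e k) * lagrange_basis J' e M j"
      unfolding lagrange_basis_def
      using prod.remove[of "J - {j}" k "\<lambda>i. (M - e i) / (e j - e i)"] k Suc.prems(1) J'_diff by simp
    ultimately show ?thesis
      by (simp add: \<alpha>'_def \<beta>'_def abs_mult abs_divide pos_le_divide_eq mult_ac)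
  qed
qed

section \<open>Interpolating one real power by others\<close>

text \<open>There are \<open>N + 1\<close> unknowns and only \<open>N\<close> equations. Completing the system by a zero row makes
  its matrix square with determinant 0.\<close>

lemma homogeneous_solution:
  fixes \<phi> :: "nat \<Rightarrow> 'x \<Rightarrow> real"
  assumes "finite X" "card X = N"
  shows "\<exists>\<alpha>. (\<exists>j\<le>N. \<alpha> j \<noteq> 0) \<and> (\<forall>x\<in>X. (\<Sum>j\<le>N. \<alpha> j * \<phi> j x) = 0)"
proof -
  obtain x where x: "bij_betw x {0..<N} X"
    using ex_bij_betw_nat_finite[OF assms(1)] assms(2) by blast
  define A where "A = mat\<^sub>r (Suc N) (Suc N)
    (\<lambda>i. if i = N then 0\<^sub>v (Suc N) else vec (Suc N) (\<lambda>j. \<phi> j (x i)))"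
  have "det A = 0" unfolding A_def by (rule det_row_0) auto
  moreover have "A \<in> carrier_mat (Suc N) (Suc N)" by (simp add: A_def)
  ultimately obtain v where v: "v \<in> carrier_vec (Suc N)" "v \<noteq> 0\<^sub>v (Suc N)"
    "A *\<^sub>v v = 0\<^sub>v (Suc N)"
    using det_0_iff_vec_prod_zero_field by blast
  have "\<exists>j\<le>N. v $ j \<noteq> 0"
  proof (rule ccontr)
    assume "\<not> ?thesis"
    then have "v = 0\<^sub>v (Suc N)" using v(1) by (intro eq_vecI) auto
    with v(2) show False by simp
  qed
  moreover have "(\<Sum>j\<le>N. v $ j * \<phi> j y) = 0" if y: "y \<in> X" for y
  proof -
    obtain i where i: "i < N" "y = x i" using x y by (auto simp: bij_betw_def)
    have "(A *\<^sub>v v) $ i = 0" using v(3) i by simp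
    moreover have "(A *\<^sub>v v) $ i = (\<Sum>j\<in>{0..<Suc N}. \<phi> j (x i) * v $ j)"
      using i v(1) by (simp add: A_def scalar_prod_def)
    moreover have "{0..<Suc N} = {..N}" by auto
    ultimately show ?thesis using i by (simp add: mult.commute)
  qed
  ultimately show ?thesis by blast
qed

text \<open>The substitution \<open>u = r * exp x\<close> turns powers on \<open>(0, r]\<close> into exponentials on
  \<open>x \<le> 0\<close>. A nontrivial combination of the \<open>N + 1\<close> exponentials vanishes at the nodes, and
  \<open>exp_sum_coeff_bound\<close> has two uses: it shows that the coefficient of \<open>exp (M * x)\<close> is not 0, so
  that one can solve for this term, and it bounds the resulting coefficients.\<close>

lemma powr_interpolation:
  fixes n :: "nat \<Rightarrow> real" and M r :: real
  assumes inj: "inj_on n {..<N}" and M: "\<And>j. j < N \<Longrightarrow> n j < M" and r: "r > 0"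
    and U: "finite U" "card U \<le> N" "\<And>u. u \<in> U \<Longrightarrow> 0 < u \<and> u \<le> r"
  obtains a where "\<And>u. u \<in> U \<Longrightarrow> u powr M = (\<Sum>j<N. a j * u powr n j)"
    and "\<And>j. j < N \<Longrightarrow> \<bar>a j\<bar> \<le> \<bar>lagrange_basis {..<N} n M j\<bar> * r powr (M - n j)"
proof -
  define X0 where "X0 = (\<lambda>u. ln (u / r)) ` U"
  have X0: "finite X0" "card X0 \<le> N" "X0 \<subseteq> {..0}"
    using U r card_image_le[OF U(1), of "\<lambda>u. ln (u / r)"] by (auto simp: X0_def intro: order_trans)
  \<comment> \<open>Repeated entries of a vector give fewer than \<open>N\<close> nodes; arbitrary
    further nodes bring their number to exactly \<open>N\<close>, as the coefficient bound requires.\<close>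
  obtain X where X: "X0 \<subseteq> X" "X \<subseteq> {..0}" "card X = N" "finite X"
  proof -
    have "infinite ({..0::real} - X0)"
      using X0(1) by (simp add: infinite_Iic)
    then obtain B where B: "finite B" "card B = N - card X0" "B \<subseteq> {..0} - X0"
      using infinite_arbitrarily_large by metis
    show thesis
    proof (rule that[of "X0 \<union> B"])
      show "card (X0 \<union> B) = N"
        using B X0 by (subst card_Un_disjoint) auto
    qed (use B X0 in auto)
  qed
  define e where "e j = (if j < N then n j else M)" for j
  obtain \<alpha> where \<alpha>: "\<exists>j\<le>N. \<alpha> j \<noteq> 0" "\<And>x. x \<in> X \<Longrightarrow> (\<Sum>j\<le>N. \<alpha> j * exp (e j * x)) = 0"
    using homogeneous_solution[OF X(4,3), of "\<lambda>j x. exp (e j * x)"] by blast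
  have split: "(\<Sum>j\<le>N. \<alpha> j * exp (e j * x)) = (\<Sum>j<N. \<alpha> j * exp (n j * x)) + \<alpha> N * exp (M * x)" for x
    by (simp add: lessThan_Suc_atMost[symmetric] e_def)
  have bound: "\<bar>\<alpha> j\<bar> \<le> \<bar>\<alpha> N\<bar> * \<bar>lagrange_basis {..<N} n M j\<bar>" if "j < N" for j
    by (rule exp_sum_coeff_bound[where X = X]) (use inj M X \<alpha>(2) split that in auto)
  have nz: "\<alpha> N \<noteq> 0"
  proof
    assume "\<alpha> N = 0"
    with bound have "\<alpha> j = 0" if "j \<le> N" for j
      using that by (cases "j = N") force+
    with \<alpha>(1) show False by blast
  qed
  have interp: "exp (M * x) = (\<Sum>j<N. - \<alpha> j / \<alpha> N * exp (n j * x))" if "x \<in> X" for x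
  proof -
    have "\<alpha> N * exp (M * x) = - (\<Sum>j<N. \<alpha> j * exp (n j * x))"
      using \<alpha>(2)[OF that] split[of x] by simp
    then have "exp (M * x) = - (\<Sum>j<N. \<alpha> j * exp (n j * x)) / \<alpha> N"
      using nz by (simp add: field_simps)
    also have "\<dots> = (\<Sum>j<N. - \<alpha> j / \<alpha> N * exp (n j * x))"
      by (simp add: sum_divide_distrib sum_negf)
    finally show ?thesis .
  qed
  show thesis
  proof (rule that[of "\<lambda>j. - \<alpha> j / \<alpha> N * r powr (M - n j)"])
    fix u assume u: "u \<in> U"
    define x where "x = ln (u / r)"
    have pw: "u powr p = r powr p * exp (p * x)" for p
      using U(3)[OF u] r by (simp add: x_def powr_def ln_div exp_add[symmetric] algebra_simps)
    have "u powr M = r powr M * (\<Sum>j<N. - \<alpha> j / \<alpha> N * exp (n j * x))"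
      using interp[of x] X(1) u by (auto simp: pw X0_def x_def)
    also have "\<dots> = (\<Sum>j<N. - \<alpha> j / \<alpha> N * r powr (M - n j) * u powr n j)"
      unfolding sum_distrib_left using r by (intro sum.cong) (simp_all add: pw powr_diff)
    finally show "u powr M = (\<Sum>j<N. - \<alpha> j / \<alpha> N * r powr (M - n j) * u powr n j)" .
  next
    fix j assume "j < N"
    then have "\<bar>- \<alpha> j / \<alpha> N\<bar> \<le> \<bar>lagrange_basis {..<N} n M j\<bar>"
      using bound[of j] nz by (simp add: divide_simps mult.commute)
    then show "\<bar>- \<alpha> j / \<alpha> N * r powr (M - n j)\<bar> \<le> \<bar>lagrange_basis {..<N} n M j\<bar> * r powr (M - n j)"
      unfolding abs_mult by (intro mult_mono) auto
  qed
qed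

section \<open>Interpolation at geometric nodes\<close>

text \<open>For distinct nodes, \<open>b\<close> lists the coefficients of the polynomial of degree less than \<open>N\<close>
  that takes the value \<open>y j\<close> at \<open>z j\<close>.\<close>

lemma lagrange_polynomial:
  fixes z y :: "nat \<Rightarrow> real"
  obtains b where "\<And>x. (\<Sum>i<N. b i * x ^ i) = (\<Sum>j<N. y j * lagrange_basis {..<N} z x j)"
proof -
  define l where "l j = (\<Prod>i\<in>{..<N} - {j}. [:- z i / (z j - z i), 1 / (z j - z i):])" for j
  define p where "p = (\<Sum>j<N. smult (y j) (l j))"
  have poly_l: "poly (l j) x = lagrange_basis {..<N} z x j" for j x
    by (simp add: l_def lagrange_basis_def poly_prod diff_divide_distrib)
  have "degree (l j) \<le> N - 1" if "j < N" for j
  proof -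
    have "degree (l j) \<le> (\<Sum>i\<in>{..<N} - {j}. 1)"
      unfolding l_def
      by (rule order_trans[OF degree_prod_sum_le], simp) (intro sum_mono, simp)
    then show ?thesis using that by simp
  qed
  then have deg: "degree p \<le> N - 1"
    unfolding p_def by (intro degree_sum_le) (auto intro: order_trans[OF degree_smult_le])
  have "(\<Sum>i<N. coeff p i * x ^ i) = poly p x" for x
  proof (cases "N = 0")
    case True
    then show ?thesis by (simp add: p_def)
  next
    case False
    then have "degree p < N" using deg by simp
    then show ?thesis
      unfolding poly_altdef by (intro sum.mono_neutral_right) (auto simp: coeff_eq_0)
  qed
  moreover have "poly p x = (\<Sum>j<N. y j * lagrange_basis {..<N} z x j)" for x
    by (simp add: p_def poly_sum poly_l)
  ultimately show thesis by (intro that[of "coeff p"]) simp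
qed

text \<open>Since \<open>(r * q ^ i) powr p = r powr p * (q powr p) ^ i\<close>, the sum over the nodes is
  \<open>r powr p\<close> times the polynomial with coefficients \<open>v i\<close>, evaluated at \<open>q powr p\<close>. Prescribing
  the sums for the exponents \<open>n j\<close> is therefore polynomial interpolation at the points
  \<open>q powr n j\<close>, and the sum for \<open>M\<close> is the value of the interpolant at \<open>q powr M\<close>.\<close>

lemma geometric_nodes_interpolation:
  fixes n y :: "nat \<Rightarrow> real" and M r q :: real
  assumes inj: "inj_on n {..<N}" and r: "r > 0" and q: "0 < q" "q < 1"
  obtains v where "\<And>j. j < N \<Longrightarrow> (\<Sum>i<N. v i * (r * q ^ i) powr n j) = y j"
    and "(\<Sum>i<N. v i * (r * q ^ i) powr M) =
      (\<Sum>j<N. r powr (M - n j) * lagrange_basis {..<N} (\<lambda>i. q powr n i) (q powr M) j * y j)"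
proof -
  define z where "z = (\<lambda>i. q powr n i)"
  have z: "inj_on z {..<N}"
    using inj q by (auto simp: z_def inj_on_def powr_inj)
  obtain v where v: "\<And>x. (\<Sum>i<N. v i * x ^ i) =
      (\<Sum>j<N. y j * r powr (- n j) * lagrange_basis {..<N} z x j)"
    using lagrange_polynomial[of N "\<lambda>j. y j * r powr (- n j)" z] by blast
  have node: "(r * q ^ i) powr p = r powr p * (q powr p) ^ i" for i p
    using r q by (simp add: powr_mult powr_realpow[symmetric] powr_powr mult.commute)
  have moment: "(\<Sum>i<N. v i * (r * q ^ i) powr p) =
      r powr p * (\<Sum>j<N. y j * r powr (- n j) * lagrange_basis {..<N} z (q powr p) j)" for p
    unfolding v[symmetric] node by (simp add: sum_distrib_left mult_ac)
  show thesis
  proof (rule that[of v])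
    fix k assume k: "k < N"
    have "(\<Sum>j<N. y j * r powr (- n j) * lagrange_basis {..<N} z (q powr n k) j) =
        (\<Sum>j<N. if j = k then y k * r powr (- n k) else 0)"
      using lagrange_basis_at_node[OF _ z, of _ k] k by (intro sum.cong) (auto simp: z_def)
    then show "(\<Sum>i<N. v i * (r * q ^ i) powr n k) = y k"
      using k r by (simp add: moment powr_minus)
  next
    show "(\<Sum>i<N. v i * (r * q ^ i) powr M) =
      (\<Sum>j<N. r powr (M - n j) * lagrange_basis {..<N} (\<lambda>i. q powr n i) (q powr M) j * y j)"
      unfolding moment z_def[symmetric] using r
      by (simp add: sum_distrib_left powr_diff powr_minus divide_inverse mult_ac)
  qed
qed

text \<open>As \<open>q\<close> tends to 1, each difference \<open>q powr a - q powr b\<close> is asymptotic to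
  \<open>(a - b) (q - 1)\<close>, and the factors \<open>q - 1\<close> cancel in every quotient of the product.\<close>

lemma lagrange_basis_powr_tendsto:
  assumes J: "finite J" "inj_on e J" "j \<in> J"
  shows "((\<lambda>q. lagrange_basis J (\<lambda>i. q powr e i) (q powr M) j) \<longlongrightarrow> lagrange_basis J e M j)
    (at_left (1::real))"
proof -
  have slope: "((\<lambda>q::real. (q powr p - 1) / (q - 1)) \<longlongrightarrow> p) (at_left 1)" for p
  proof -
    have "((\<lambda>q::real. q powr p) has_field_derivative p) (at 1)"
      by (auto intro!: derivative_eq_intros)
    then have "((\<lambda>q::real. (q powr p - 1) / (q - 1)) \<longlongrightarrow> p) (at 1)"
      by (simp add: has_field_derivative_iff)
    then show ?thesis by (rule tendsto_mono[rotated]) (simp add: at_le)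
  qed
  have slope_diff: "((\<lambda>q::real. (q powr p - q powr s) / (q - 1)) \<longlongrightarrow> p - s) (at_left 1)" for p s
    using tendsto_diff[OF slope[of p] slope[of s]] by (simp add: diff_divide_distrib[symmetric])
  have "((\<lambda>q::real. (q powr M - q powr e i) / (q powr e j - q powr e i)) \<longlongrightarrow>
      (M - e i) / (e j - e i)) (at_left 1)" if i: "i \<in> J - {j}" for i
  proof (rule Lim_transform_eventually)
    show "((\<lambda>q. ((q powr M - q powr e i) / (q - 1)) / ((q powr e j - q powr e i) / (q - 1)))
        \<longlongrightarrow> (M - e i) / (e j - e i)) (at_left 1)"
      using i J by (intro tendsto_divide slope_diff) (auto dest: inj_onD)
    show "\<forall>\<^sub>F q in at_left 1. ((q powr M - q powr e i) / (q - 1)) / ((q powr e j - q powr e i) / (q - 1))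
        = (q powr M - q powr e i) / (q powr e j - q powr e i)"
      by (auto simp: eventually_at_filter)
  qed
  then show ?thesis unfolding lagrange_basis_def by (intro tendsto_prod) auto
qed

section \<open>Vandermonde ratios\<close>

lemma vandermonde_snoc:
  "vandermonde (xs @ [x]) = vandermonde xs * prod_list (map (\<lambda>t. x - t) xs)"
proof -
  have "prod_list (map (\<lambda>t. x - t) xs) = (\<Prod>i<length xs. x - xs ! i)"
    by (simp add: prod.list_conv_set_nth atLeast0LessThan)
  then show ?thesis
    by (simp add: vandermonde_def nth_append cong: prod.cong_simp)
qed

text \<open>Squaring removes the sign that depends on the position of \<open>y\<close> in the list.\<close>

lemma vandermonde_insert_squared:
  "(vandermonde (xs @ y # ys))\<^sup>2 =
    (vandermonde (xs @ ys))\<^sup>2 * (prod_list (map (\<lambda>t. y - t) (xs @ ys)))\<^sup>2"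
proof (induction ys rule: rev_induct)
  case Nil
  then show ?case by (simp add: vandermonde_snoc power_mult_distrib)
next
  case (snoc z ys)
  have "vandermonde (xs @ y # ys @ [z]) =
      vandermonde (xs @ y # ys) * prod_list (map (\<lambda>t. z - t) (xs @ ys)) * (z - y)"
    using vandermonde_snoc[of "xs @ y # ys" z] by (simp add: mult_ac)
  moreover have "vandermonde (xs @ ys @ [z]) =
      vandermonde (xs @ ys) * prod_list (map (\<lambda>t. z - t) (xs @ ys))"
    using vandermonde_snoc[of "xs @ ys" z] by simp
  moreover have "(z - y)\<^sup>2 = (y - z)\<^sup>2" by (rule power2_commute)
  ultimately show ?case
    using snoc by (simp add: power_mult_distrib mult_ac)
qed

lemma vandermonde_nonzero:
  fixes ts :: "'a::idom list"
  shows "distinct ts \<Longrightarrow> vandermonde ts \<noteq> 0"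
  by (auto simp: vandermonde_def nth_eq_iff_index_eq)

text \<open>Both lists contain the exponents other than \<open>n j\<close>, whose Vandermonde determinant cancels. What
  remains are the differences of \<open>M\<close>, respectively of \<open>n j\<close>, with the other exponents.\<close>

lemma vandermonde_ratio_squared:
  assumes inj: "inj_on n {..<N}" and j: "j < N"
  shows "(vandermonde (exponents_omit N n M j))\<^sup>2 / (vandermonde (exponents N n))\<^sup>2 =
    (lagrange_basis {..<N} n M j)\<^sup>2"
proof -
  define ks where "ks = [0..<j] @ [Suc j..<N]"
  have ks_props: "distinct ks" "set ks = {..<N} - {j}"
    using j by (auto simp: ks_def)
  have "[0..<N] = [0..<j] @ j # [Suc j..<N]"
    using j upt_add_eq_append[of 0 j "N - j"] by (simp add: upt_conv_Cons)
  then have ex: "exponents N n = map n [0..<j] @ n j # map n [Suc j..<N]"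
    by (simp add: exponents_def)
  have pl: "prod_list (map (\<lambda>t. x - t) (map n ks)) = (\<Prod>i\<in>{..<N} - {j}. x - n i)" for x
    using ks_props by (simp add: prod.distinct_set_conv_list[symmetric] comp_def)
  have "(vandermonde (exponents N n))\<^sup>2 =
      (vandermonde (map n ks))\<^sup>2 * (\<Prod>i\<in>{..<N} - {j}. n j - n i)\<^sup>2"
    using pl[of "n j"] by (simp add: ex vandermonde_insert_squared ks_def)
  moreover have "vandermonde (exponents_omit N n M j) =
      vandermonde (map n ks) * (\<Prod>i\<in>{..<N} - {j}. M - n i)"
    using vandermonde_snoc[of "map n ks" M] pl[of M] by (simp add: exponents_omit_def ks_def)
  moreover have "vandermonde (map n ks) \<noteq> 0"
    using ks_props inj by (intro vandermonde_nonzero) (auto simp: distinct_map intro: inj_on_subset)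
  ultimately show ?thesis
    by (simp add: lagrange_basis_def prod_dividef power_mult_distrib power_divide)
qed

text \<open>The squares in this form match the coefficient bound of \<open>powr_interpolation\<close> for
  \<open>r = sqrt \<rho>\<close>.\<close>

lemma threshold_eq:
  assumes "inj_on n {..<N}" "\<rho> > 0"
  shows "threshold N n M \<rho> c = (\<Sum>j<N. (sqrt \<rho> powr (M - n j) * lagrange_basis {..<N} n M j)\<^sup>2 / c j)"
proof -
  have "(sqrt \<rho> powr p)\<^sup>2 = \<rho> powr p" for p
    using assms(2) by (simp add: power2_eq_square powr_mult[symmetric])
  then show ?thesis
    unfolding threshold_def using vandermonde_ratio_squared[OF assms(1)]
    by (intro sum.cong) (simp_all add: power_mult_distrib mult_ac)
qed

lemma threshold_pos:
  assumes "N > 0" "inj_on n {..<N}" "\<And>j. j < N \<Longrightarrow> n j < M" "\<rho> > 0" "\<And>j. j < N \<Longrightarrow> c j > 0"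
  shows "threshold N n M \<rho> c > 0"
proof -
  have "lagrange_basis {..<N} n M j \<noteq> 0" if "j < N" for j
    using assms(2) assms(3)[of _] that by (intro lagrange_basis_nonzero) force+
  then show ?thesis
    unfolding threshold_eq[OF assms(2,4)] using assms by (intro sum_pos) (auto intro!: divide_pos_pos)
qed

section \<open>Real positive semidefinite matrices of rank one\<close>

lemma pos_semidef_real_iff:
  fixes A :: "real mat"
  assumes A: "A \<in> carrier_mat N N"
  shows "pos_semidef N A \<longleftrightarrow> (\<forall>i<N. \<forall>j<N. A $$ (i, j) = A $$ (j, i)) \<and>
    (\<forall>v. 0 \<le> (\<Sum>i<N. \<Sum>j<N. A $$ (i, j) * v i * v j))"
proof -
  have adj: "mat_adjoint A = mat N N (\<lambda>(i, j). A $$ (j, i))"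
    using A by (intro eq_matI) (auto simp: mat_adjoint_def mat_of_rows_index)
  have "mat_adjoint A = A \<longleftrightarrow> (\<forall>i<N. \<forall>j<N. A $$ (i, j) = A $$ (j, i))"
    unfolding adj using A by (auto simp: mat_eq_iff)
  moreover have form: "(A *\<^sub>v vec N v) \<bullet>c vec N v = (\<Sum>i<N. \<Sum>j<N. A $$ (i, j) * v i * v j)" for v
    using A by (simp add: scalar_prod_def atLeast0LessThan sum_distrib_left mult_ac)
  have "(\<forall>v\<in>carrier_vec N. 0 \<le> (A *\<^sub>v v) \<bullet>c v) \<longleftrightarrow>
      (\<forall>v. 0 \<le> (\<Sum>i<N. \<Sum>j<N. A $$ (i, j) * v i * v j))"
  proof
    assume "\<forall>v\<in>carrier_vec N. 0 \<le> (A *\<^sub>v v) \<bullet>c v"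
    then show "\<forall>v. 0 \<le> (\<Sum>i<N. \<Sum>j<N. A $$ (i, j) * v i * v j)"
      by (metis form vec_carrier)
  next
    assume pos: "\<forall>v. 0 \<le> (\<Sum>i<N. \<Sum>j<N. A $$ (i, j) * v i * v j)"
    show "\<forall>v\<in>carrier_vec N. 0 \<le> (A *\<^sub>v v) \<bullet>c v"
    proof
      fix v :: "real vec" assume "v \<in> carrier_vec N"
      then have "v = vec N (\<lambda>i. v $ i)" by auto
      then show "0 \<le> (A *\<^sub>v v) \<bullet>c v" using pos form by metis
    qed
  qed
  ultimately show ?thesis using A by (simp add: pos_semidef_def)
qed

lemma det_two_by_two:
  assumes "A \<in> carrier_mat 2 2"
  shows "det A = A $$ (0, 0) * A $$ (1, 1) - A $$ (1, 0) * A $$ (0, 1)"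
proof -
  have "det (mat_delete A i 0) = A $$ (1 - i, 1)" if "i < 2" for i
    using that assms by (subst det_single) (auto simp: mat_delete_def)
  then show ?thesis
    using laplace_expansion_column[OF assms, of 0]
    by (simp add: cofactor_def numeral_2_eq_2)
qed

text \<open>The rank is at least the order of every invertible submatrix, here the one formed by the rows
  and columns \<open>i\<close> and \<open>j\<close>.\<close>

lemma rank_le_1_minor_eq_0:
  fixes A :: "'a::field mat"
  assumes A: "A \<in> carrier_mat N nc" and rank: "mat_rank N A \<le> 1"
    and ij: "i < j" "j < N" "j < nc"
  shows "A $$ (i, i) * A $$ (j, j) = A $$ (i, j) * A $$ (j, i)"
proof (rule ccontr)
  assume neq: "\<not> ?thesis"
  define B where "B = submatrix A {i, j} {i, j}"
  have sets: "{k. k < N \<and> k \<in> {i, j}} = {i, j}" "{k. k < nc \<and> k \<in> {i, j}} = {i, j}"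
    using ij by auto
  have pos: "card {a \<in> {i, j}. a < i} = 0" "card {a \<in> {i, j}. a < j} = 1"
  proof -
    have "{a \<in> {i, j}. a < i} = {}" "{a \<in> {i, j}. a < j} = {i}" using ij by auto
    then show "card {a \<in> {i, j}. a < i} = 0" "card {a \<in> {i, j}. a < j} = 1" by simp_all
  qed
  have card2: "card {i, j} = 2" using ij by simp
  have B: "B \<in> carrier_mat 2 2"
    unfolding B_def using A sets card2 by (intro carrier_matI) (simp_all add: dim_submatrix)
  have entry: "B $$ (card {a \<in> {i, j}. a < k}, card {a \<in> {i, j}. a < l}) = A $$ (k, l)"
    if "k \<in> {i, j}" "l \<in> {i, j}" for k l
    unfolding B_def using A ij that by (intro submatrix_index_card) auto
  have "B $$ (0, 0) = A $$ (i, i)" "B $$ (1, 1) = A $$ (j, j)"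
    "B $$ (0, 1) = A $$ (i, j)" "B $$ (1, 0) = A $$ (j, i)"
    using entry[of i i] entry[of j j] entry[of i j] entry[of j i] unfolding pos by auto
  then have "det B \<noteq> 0" using neq det_two_by_two[OF B] by (simp add: mult.commute)
  then have "card {k. k < nc \<and> k \<in> {i, j}} \<le> mat_rank N A"
    unfolding B_def by (rule vec_space.rank_gt_minor[OF A])
  with rank card2 sets show False by simp
qed

lemma rank_gt_0_if_corner_nonzero:
  fixes A :: "'a::field mat"
  assumes A: "A \<in> carrier_mat N nc" and "N > 0" "nc > 0" and nz: "A $$ (0, 0) \<noteq> 0"
  shows "mat_rank N A \<ge> 1"
proof -
  define B where "B = submatrix A {0} {0}"
  have sets: "{k. k < N \<and> k \<in> {0}} = {0}" "{k. k < nc \<and> k \<in> {0}} = {0}"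
    using assms by auto
  have B: "B \<in> carrier_mat 1 1"
    unfolding B_def using A sets by (intro carrier_matI) (simp_all add: dim_submatrix)
  have "B $$ (0, 0) = A $$ (0, 0)"
    using submatrix_index_card[of 0 A 0 "{0}" "{0}"] assms by (simp add: B_def)
  then have "det B \<noteq> 0" using nz det_single[OF B] by simp
  then have "card {k. k < nc \<and> k \<in> {0}} \<le> mat_rank N A"
    unfolding B_def by (rule vec_space.rank_gt_minor[OF A])
  with sets show ?thesis by simp
qed

text \<open>Conversely to \<open>u u\<^sup>T\<close> being positive semidefinite of rank one, the vanishing 2 by 2 minors give
  \<open>A\<^bsub>ij\<^esub>\<^sup>2 = A\<^bsub>ii\<^esub> A\<^bsub>jj\<^esub>\<close>. As the entries are positive,
  \<open>u\<^sub>i = \<surd>A\<^bsub>ii\<^esub>\<close> is the required vector.\<close>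

lemma rank_one_psd_mats_iff:
  assumes "N > 0"
  shows "A \<in> psd_mats N {0<..<\<rho>} \<and> mat_rank N A = 1 \<longleftrightarrow>
    (\<exists>u. (\<forall>i<N. 0 < u i \<and> u i < sqrt \<rho>) \<and> A = mat N N (\<lambda>(i, j). u i * u j))"
proof
  assume asm: "A \<in> psd_mats N {0<..<\<rho>} \<and> mat_rank N A = 1"
  then have A: "A \<in> carrier_mat N N" and psd: "pos_semidef N A"
    and elts: "elements_mat A \<subseteq> {0<..<\<rho>}" and rank: "mat_rank N A \<le> 1"
    by (auto simp: psd_mats_def pos_semidef_def)
  have entry: "0 < A $$ (i, j)" "A $$ (i, j) < \<rho>" if "i < N" "j < N" for i j
    using elts elements_matI[OF A that refl] by auto
  have sym: "A $$ (i, j) = A $$ (j, i)" if "i < N" "j < N" for i j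
    using psd that unfolding pos_semidef_real_iff[OF A] by blast
  have minor: "A $$ (i, i) * A $$ (j, j) = (A $$ (i, j))\<^sup>2" if "i < N" "j < N" for i j
    using rank_le_1_minor_eq_0[OF A rank, of i j] rank_le_1_minor_eq_0[OF A rank, of j i]
      sym[OF that] that
    by (cases i j rule: linorder_cases) (auto simp: power2_eq_square mult.commute)
  define u where "u i = sqrt (A $$ (i, i))" for i
  have "A $$ (i, j) = u i * u j" if "i < N" "j < N" for i j
    using minor[OF that] entry[OF that] by (simp add: u_def real_sqrt_mult[symmetric])
  then have "A = mat N N (\<lambda>(i, j). u i * u j)" using A by (intro eq_matI) auto
  moreover have "\<forall>i<N. 0 < u i \<and> u i < sqrt \<rho>" using entry by (simp add: u_def)
  ultimately show "\<exists>u. (\<forall>i<N. 0 < u i \<and> u i < sqrt \<rho>) \<and> A = mat N N (\<lambda>(i, j). u i * u j)"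
    by blast
next
  assume "\<exists>u. (\<forall>i<N. 0 < u i \<and> u i < sqrt \<rho>) \<and> A = mat N N (\<lambda>(i, j). u i * u j)"
  then obtain u where u: "\<And>i. i < N \<Longrightarrow> 0 < u i \<and> u i < sqrt \<rho>"
    and Au: "A = mat N N (\<lambda>(i, j). u i * u j)" by blast
  have A: "A \<in> carrier_mat N N" by (simp add: Au)
  have bounds: "0 < u i * u j \<and> u i * u j < \<rho>" if "i < N" "j < N" for i j
  proof -
    have "0 < sqrt \<rho>" using u[OF that(1)] by linarith
    then have "u i * u j < sqrt \<rho> * sqrt \<rho>"
      using u[OF that(1)] u[OF that(2)] by (intro mult_strict_mono) auto
    then show ?thesis using \<open>0 < sqrt \<rho>\<close> u[OF that(1)] u[OF that(2)] by simp
  qed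
  have "(\<Sum>i<N. \<Sum>j<N. A $$ (i, j) * v i * v j) = (\<Sum>i<N. u i * v i)\<^sup>2" for v
    by (simp add: Au power2_eq_square sum_product mult_ac)
  then have "pos_semidef N A"
    unfolding pos_semidef_real_iff[OF A] by (simp add: Au mult.commute)
  moreover have "elements_mat A \<subseteq> {0<..<\<rho>}"
    using bounds by (auto simp: Au dest!: elements_matD)
  moreover have "mat_rank N A = 1"
  proof (rule antisym)
    show "mat_rank N A \<le> 1"
      by (rule vec_space.rank_le_1_product_entries[OF A, of u u]) (simp add: Au)
    show "1 \<le> mat_rank N A"
      using bounds[OF assms assms] assms by (intro rank_gt_0_if_corner_nonzero[OF A]) (auto simp: Au)
  qed
  ultimately show "A \<in> psd_mats N {0<..<\<rho>} \<and> mat_rank N A = 1"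
    by (simp add: psd_mats_def)
qed

section \<open>The quadratic form of the transformed matrix\<close>

text \<open>Entrywise, \<open>(u u\<^sup>T) powr p\<close> is again the rank-one matrix of the vector \<open>u powr p\<close>.\<close>

lemma entrywise_power_sum_form:
  fixes u v :: "nat \<Rightarrow> real"
  assumes "\<And>i. i < N \<Longrightarrow> 0 < u i"
  shows "(\<Sum>i<N. \<Sum>k<N. ((\<Sum>j<m. c j * (u i * u k) powr n j) + c' * (u i * u k) powr M) * v i * v k) =
    (\<Sum>j<m. c j * (\<Sum>i<N. v i * u i powr n j)\<^sup>2) + c' * (\<Sum>i<N. v i * u i powr M)\<^sup>2"
proof -
  have sq: "(\<Sum>i<N. v i * u i powr p)\<^sup>2 = (\<Sum>i<N. \<Sum>k<N. (u i * u k) powr p * v i * v k)" for p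
    using assms by (auto simp: power2_eq_square sum_product powr_mult mult_ac intro!: sum.cong)
  have "(\<Sum>i<N. \<Sum>k<N. ((\<Sum>j<m. c j * (u i * u k) powr n j) + c' * (u i * u k) powr M) * v i * v k) =
      (\<Sum>i<N. \<Sum>k<N. \<Sum>j<m. c j * ((u i * u k) powr n j * v i * v k)) +
      (\<Sum>i<N. \<Sum>k<N. c' * ((u i * u k) powr M * v i * v k))"
    by (simp add: sum.distrib distrib_right sum_distrib_right mult.assoc)
  also have "(\<Sum>i<N. \<Sum>k<N. \<Sum>j<m. c j * ((u i * u k) powr n j * v i * v k)) =
      (\<Sum>j<m. c j * (\<Sum>i<N. v i * u i powr n j)\<^sup>2)"
  proof -
    have "(\<Sum>i<N. \<Sum>k<N. \<Sum>j<m. c j * ((u i * u k) powr n j * v i * v k)) =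
        (\<Sum>i<N. \<Sum>j<m. \<Sum>k<N. c j * ((u i * u k) powr n j * v i * v k))"
      by (intro sum.cong refl sum.swap)
    also have "\<dots> = (\<Sum>j<m. \<Sum>i<N. \<Sum>k<N. c j * ((u i * u k) powr n j * v i * v k))"
      by (rule sum.swap)
    finally show ?thesis by (simp add: sq sum_distrib_left)
  qed
  also have "(\<Sum>i<N. \<Sum>k<N. c' * ((u i * u k) powr M * v i * v k)) =
      c' * (\<Sum>i<N. v i * u i powr M)\<^sup>2"
    by (simp add: sq sum_distrib_left)
  finally show ?thesis .
qed

lemma preserves_positivity_on_rank_one_iff:
  assumes N: "N > 0" and f: "f = (\<lambda>x. (\<Sum>j<m. c j * x powr n j) + c' * x powr M)"
  shows "preserves_positivity_on N f {A \<in> psd_mats N {0<..<\<rho>}. mat_rank N A = 1} \<longleftrightarrow>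
    (\<forall>u v. (\<forall>i<N. 0 < u i \<and> u i < sqrt \<rho>) \<longrightarrow>
      0 \<le> (\<Sum>j<m. c j * (\<Sum>i<N. v i * u i powr n j)\<^sup>2) + c' * (\<Sum>i<N. v i * u i powr M)\<^sup>2)"
proof -
  have psd_iff: "pos_semidef N (map_mat f (mat N N (\<lambda>(i, j). u i * u j))) \<longleftrightarrow>
      (\<forall>v. 0 \<le> (\<Sum>j<m. c j * (\<Sum>i<N. v i * u i powr n j)\<^sup>2) + c' * (\<Sum>i<N. v i * u i powr M)\<^sup>2)"
    if "\<forall>i<N. 0 < u i \<and> u i < sqrt \<rho>" for u
  proof -
    have "map_mat f (mat N N (\<lambda>(i, j). u i * u j)) \<in> carrier_mat N N" by simp
    note iff = pos_semidef_real_iff[OF this]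
    have "(\<Sum>i<N. \<Sum>k<N. map_mat f (mat N N (\<lambda>(i, j). u i * u j)) $$ (i, k) * v i * v k) =
        (\<Sum>j<m. c j * (\<Sum>i<N. v i * u i powr n j)\<^sup>2) + c' * (\<Sum>i<N. v i * u i powr M)\<^sup>2" for v
      using entrywise_power_sum_form[of N u c n m c' M v] that by (simp add: f)
    then show ?thesis unfolding iff by (simp add: mult.commute)
  qed
  have rank_one_set: "{A \<in> psd_mats N {0<..<\<rho>}. mat_rank N A = 1} =
      {mat N N (\<lambda>(i, j). u i * u j) | u. \<forall>i<N. 0 < u i \<and> u i < sqrt \<rho>}"
    using rank_one_psd_mats_iff[OF N] by blast
  have ball_setcompr: "(\<forall>A\<in>{g u | u. P u}. Q A) \<longleftrightarrow> (\<forall>u. P u \<longrightarrow> Q (g u))"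
    for g :: "(nat \<Rightarrow> real) \<Rightarrow> real mat" and P Q by blast
  have "preserves_positivity_on N f {A \<in> psd_mats N {0<..<\<rho>}. mat_rank N A = 1} \<longleftrightarrow>
      (\<forall>u. (\<forall>i<N. 0 < u i \<and> u i < sqrt \<rho>) \<longrightarrow>
        pos_semidef N (map_mat f (mat N N (\<lambda>(i, j). u i * u j))))"
    unfolding preserves_positivity_on_def rank_one_set by (rule ball_setcompr)
  also have "\<dots> \<longleftrightarrow> (\<forall>u. (\<forall>i<N. 0 < u i \<and> u i < sqrt \<rho>) \<longrightarrow> (\<forall>v.
      0 \<le> (\<Sum>j<m. c j * (\<Sum>i<N. v i * u i powr n j)\<^sup>2) + c' * (\<Sum>i<N. v i * u i powr M)\<^sup>2))"
    by (intro all_cong1 imp_cong refl psd_iff)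
  finally show ?thesis by simp
qed

section \<open>Sufficiency of the threshold\<close>

lemma weighted_Cauchy_Schwarz:
  fixes a b s :: "'i \<Rightarrow> real"
  assumes "\<And>j. j \<in> J \<Longrightarrow> c j > 0"
  shows "(\<Sum>j\<in>J. a j * s j)\<^sup>2 \<le> (\<Sum>j\<in>J. (a j)\<^sup>2 / c j) * (\<Sum>j\<in>J. c j * (s j)\<^sup>2)"
proof -
  have "(a j / sqrt (c j)) * (sqrt (c j) * s j) = a j * s j" if "j \<in> J" for j
    using assms[OF that] by simp
  then have "(\<Sum>j\<in>J. a j * s j)\<^sup>2 = (\<Sum>j\<in>J. (a j / sqrt (c j)) * (sqrt (c j) * s j))\<^sup>2"
    by (simp cong: sum.cong_simp)
  also have "\<dots> \<le> (\<Sum>j\<in>J. (a j / sqrt (c j))\<^sup>2) * (\<Sum>j\<in>J. (sqrt (c j) * s j)\<^sup>2)"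
    by (rule Cauchy_Schwarz_ineq_sum)
  also have "\<dots> = (\<Sum>j\<in>J. (a j)\<^sup>2 / c j) * (\<Sum>j\<in>J. c j * (s j)\<^sup>2)"
    using assms by (simp add: power_divide power_mult_distrib less_imp_le cong: sum.cong_simp)
  finally show ?thesis .
qed

text \<open>Interpolating \<open>x powr M\<close> at the entries of \<open>u\<close> expresses the last sum by the other sums \<open>s j\<close>.
  The coefficient bounds and Cauchy-Schwarz with weights \<open>c j\<close> show that its square is at most the
  threshold times \<open>\<Sum>j<N. c j * (s j)\<^sup>2\<close>.\<close>

lemma form_nonneg_above_threshold:
  fixes n c u v :: "nat \<Rightarrow> real"
  assumes inj: "inj_on n {..<N}" and M: "\<And>j. j < N \<Longrightarrow> n j < M" and \<rho>: "\<rho> > 0"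
    and c: "\<And>j. j < N \<Longrightarrow> c j > 0" and N: "N > 0"
    and c': "c' \<ge> - inverse (threshold N n M \<rho> c)"
    and u: "\<And>i. i < N \<Longrightarrow> 0 < u i \<and> u i \<le> sqrt \<rho>"
  shows "0 \<le> (\<Sum>j<N. c j * (\<Sum>i<N. v i * u i powr n j)\<^sup>2) + c' * (\<Sum>i<N. v i * u i powr M)\<^sup>2"
proof -
  define s where "s j = (\<Sum>i<N. v i * u i powr n j)" for j
  define S where "S = (\<Sum>j<N. c j * (s j)\<^sup>2)"
  define C where "C = threshold N n M \<rho> c"
  have C: "C > 0" unfolding C_def by (rule threshold_pos[OF N inj M \<rho> c])
  have S: "S \<ge> 0" unfolding S_def by (intro sum_nonneg mult_nonneg_nonneg) (auto intro: less_imp_le c)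
  obtain a where a: "\<And>x. x \<in> u ` {..<N} \<Longrightarrow> x powr M = (\<Sum>j<N. a j * x powr n j)"
    "\<And>j. j < N \<Longrightarrow> \<bar>a j\<bar> \<le> \<bar>lagrange_basis {..<N} n M j\<bar> * sqrt \<rho> powr (M - n j)"
  proof (rule powr_interpolation[OF inj M, of "sqrt \<rho>" "u ` {..<N}"])
    show "card (u ` {..<N}) \<le> N" using card_image_le[of "{..<N}" u] by simp
  qed (use \<rho> u in auto)
  have "(\<Sum>i<N. v i * u i powr M) = (\<Sum>i<N. \<Sum>j<N. a j * (v i * u i powr n j))"
    using a(1) by (intro sum.cong) (auto simp: sum_distrib_left mult_ac)
  also have "\<dots> = (\<Sum>j<N. a j * s j)"
    unfolding s_def sum_distrib_left by (rule sum.swap)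
  finally have w: "(\<Sum>i<N. v i * u i powr M) = (\<Sum>j<N. a j * s j)" .
  have "(\<Sum>j<N. (a j)\<^sup>2 / c j) \<le> C"
    unfolding C_def threshold_eq[OF inj \<rho>]
  proof (intro sum_mono divide_right_mono)
    fix j assume "j \<in> {..<N}"
    then have "\<bar>a j\<bar> \<le> \<bar>sqrt \<rho> powr (M - n j) * lagrange_basis {..<N} n M j\<bar>"
      using a(2)[of j] by (simp add: abs_mult mult.commute)
    then show "(a j)\<^sup>2 \<le> (sqrt \<rho> powr (M - n j) * lagrange_basis {..<N} n M j)\<^sup>2"
      by (simp add: abs_le_square_iff)
  qed (use c in \<open>auto intro: less_imp_le\<close>)
  then have "(\<Sum>j<N. (a j)\<^sup>2 / c j) * S \<le> C * S"
    using S by (rule mult_right_mono)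
  moreover have "(\<Sum>j<N. a j * s j)\<^sup>2 \<le> (\<Sum>j<N. (a j)\<^sup>2 / c j) * S"
    unfolding S_def using c by (intro weighted_Cauchy_Schwarz) simp
  ultimately have "inverse C * (\<Sum>j<N. a j * s j)\<^sup>2 \<le> inverse C * (C * S)"
    using C by (intro mult_left_mono) auto
  then have "- S \<le> - inverse C * (\<Sum>j<N. a j * s j)\<^sup>2"
    using C by (simp add: mult.assoc[symmetric])
  also have "\<dots> \<le> c' * (\<Sum>j<N. a j * s j)\<^sup>2"
    using c' by (intro mult_right_mono) (auto simp: C_def)
  finally show ?thesis unfolding w S_def s_def by simp
qed

section \<open>Necessity of the threshold\<close>

text \<open>Evaluating the form at geometric nodes leaves a quadratic form in freely chosen \<open>y\<close>.\<close>

lemma form_at_geometric_nodes: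
  fixes n c y :: "nat \<Rightarrow> real"
  assumes inj: "inj_on n {..<N}"
    and r: "0 < r" "r < sqrt \<rho>" and q: "0 < q" "q < 1"
    and pos: "\<And>u v. (\<And>i. i < N \<Longrightarrow> 0 < u i \<and> u i < sqrt \<rho>) \<Longrightarrow>
      0 \<le> (\<Sum>j<N. c j * (\<Sum>i<N. v i * u i powr n j)\<^sup>2) + c' * (\<Sum>i<N. v i * u i powr M)\<^sup>2"
  shows "0 \<le> (\<Sum>j<N. c j * (y j)\<^sup>2) +
    c' * (\<Sum>j<N. r powr (M - n j) * lagrange_basis {..<N} (\<lambda>i. q powr n i) (q powr M) j * y j)\<^sup>2"
proof -
  obtain v where v: "\<And>j. j < N \<Longrightarrow> (\<Sum>i<N. v i * (r * q ^ i) powr n j) = y j"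
    "(\<Sum>i<N. v i * (r * q ^ i) powr M) =
      (\<Sum>j<N. r powr (M - n j) * lagrange_basis {..<N} (\<lambda>i. q powr n i) (q powr M) j * y j)"
    by (rule geometric_nodes_interpolation[OF inj r(1) q, where y = y and M = M]) (rule that; simp)
  have "0 < r * q ^ i \<and> r * q ^ i < sqrt \<rho>" for i
  proof -
    have "r * q ^ i \<le> r * 1" using r q by (intro mult_left_mono power_le_one) auto
    then have "r * q ^ i < sqrt \<rho>" using r(2) by linarith
    then show ?thesis using r q by simp
  qed
  from pos[of "\<lambda>i. r * q ^ i" v, OF this] show ?thesis using v by simp
qed

lemma single_coefficient_nonneg:
  fixes n c :: "nat \<Rightarrow> real"
  assumes inj: "inj_on n {..<N}" and k: "k < N"
    and r: "0 < r" "r < sqrt \<rho>" and q: "0 < q" "q < 1"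
    and pos: "\<And>u v. (\<And>i. i < N \<Longrightarrow> 0 < u i \<and> u i < sqrt \<rho>) \<Longrightarrow>
      0 \<le> (\<Sum>j<N. c j * (\<Sum>i<N. v i * u i powr n j)\<^sup>2) + c' * (\<Sum>i<N. v i * u i powr M)\<^sup>2"
  shows "0 \<le> c k + c' * (r powr (M - n k) * lagrange_basis {..<N} (\<lambda>i. q powr n i) (q powr M) k)\<^sup>2"
proof -
  define y where "y j = (if j = k then 1 else 0 :: real)" for j
  have y_eq: "t * (y j)\<^sup>2 = (if j = k then t else 0)" "t * y j = (if j = k then t else 0)" for t j
    by (simp_all add: y_def)
  have "(\<Sum>j<N. c j * (y j)\<^sup>2) = c k"
    "(\<Sum>j<N. r powr (M - n j) * lagrange_basis {..<N} (\<lambda>i. q powr n i) (q powr M) j * y j) =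
      r powr (M - n k) * lagrange_basis {..<N} (\<lambda>i. q powr n i) (q powr M) k"
    using k sum.delta[of "{..<N}" k c]
      sum.delta[of "{..<N}" k "\<lambda>j. r powr (M - n j) * lagrange_basis {..<N} (\<lambda>i. q powr n i) (q powr M) j"]
    by (simp_all add: y_eq)
  with form_at_geometric_nodes[OF inj r q pos, where y = y] show ?thesis by simp
qed

text \<open>Taking \<open>y\<close> as a unit vector gives \<open>0 \<le> c k + c' * (r powr (M - n k) * l)\<^sup>2\<close> with
  \<open>l \<noteq> 0\<close>. Because \<open>M\<close> exceeds \<open>n k\<close>, the second summand tends to 0 as \<open>r\<close> does, while
  for a fixed \<open>r\<close> it is strictly negative if \<open>c'\<close> is.\<close>

lemma coefficients_nonneg:
  fixes n c :: "nat \<Rightarrow> real"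
  assumes inj: "inj_on n {..<N}" and M: "\<And>j. j < N \<Longrightarrow> n j < M" and \<rho>: "\<rho> > 0" and k: "k < N"
    and pos: "\<And>u v. (\<And>i. i < N \<Longrightarrow> 0 < u i \<and> u i < sqrt \<rho>) \<Longrightarrow>
      0 \<le> (\<Sum>j<N. c j * (\<Sum>i<N. v i * u i powr n j)\<^sup>2) + c' * (\<Sum>i<N. v i * u i powr M)\<^sup>2"
  shows "c k \<ge> 0" and "c' < 0 \<Longrightarrow> c k > 0"
proof -
  \<comment> \<open>Any ratio strictly between 0 and 1 would serve in place of 1/2.\<close>
  define l where "l = lagrange_basis {..<N} (\<lambda>i. (1 / 2 :: real) powr n i) ((1 / 2) powr M) k"
  have ineq: "0 \<le> c k + c' * (r powr (M - n k) * l)\<^sup>2" if "0 < r" "r < sqrt \<rho>" for r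
    unfolding l_def using that by (intro single_coefficient_nonneg[OF inj k _ _ _ _ pos]) auto
  have small: "\<forall>\<^sub>F r in at_right 0. 0 < r \<and> r < sqrt \<rho>"
    using \<rho> by (intro eventually_at_rightI[of 0 "sqrt \<rho>"]) auto
  have "((\<lambda>r::real. r powr (M - n k)) \<longlongrightarrow> 0) (at_right 0)"
    using M[OF k] by (intro tendsto_zero_powrI tendsto_const tendsto_ident_at)
      (auto simp: eventually_at_filter)
  from tendsto_add[OF tendsto_const tendsto_mult[OF tendsto_const tendsto_power[OF tendsto_mult[OF this tendsto_const]]]]
  have "((\<lambda>r. c k + c' * (r powr (M - n k) * l)\<^sup>2) \<longlongrightarrow> c k + c' * (0 * l)\<^sup>2) (at_right 0)" .
  moreover have "\<forall>\<^sub>F r in at_right 0. 0 \<le> c k + c' * (r powr (M - n k) * l)\<^sup>2"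
    using small by (rule eventually_mono) (use ineq in blast)
  ultimately have "0 \<le> c k + c' * (0 * l)\<^sup>2"
    by (rule tendsto_lowerbound) simp
  then show "c k \<ge> 0" by simp
  assume c': "c' < 0"
  have "l \<noteq> 0"
    unfolding l_def
  proof (rule lagrange_basis_nonzero)
    show "inj_on (\<lambda>i. (1 / 2 :: real) powr n i) {..<N}"
      using inj by (auto simp: inj_on_def powr_inj)
    show "(1 / 2) powr M \<notin> (\<lambda>i. (1 / 2) powr n i) ` ({..<N} - {k})"
      using M by (force simp: powr_inj)
  qed (use k in auto)
  moreover define r where "r = sqrt \<rho> / 2"
  moreover have "0 < r" "r < sqrt \<rho>" using \<rho> by (auto simp: r_def)
  ultimately have "c' * (r powr (M - n k) * l)\<^sup>2 < 0"
    using c' by (simp add: mult_less_0_iff)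
  then show "c k > 0" using ineq[OF \<open>0 < r\<close> \<open>r < sqrt \<rho>\<close>] by linarith
qed

text \<open>The choice \<open>y j = a q j / c j\<close> makes both sums in the form equal to
  \<open>C q = (\<Sum>j<N. (a q j)\<^sup>2 / c j)\<close>. With \<open>r = sqrt \<rho> * q\<close> all nodes lie below
  \<open>sqrt \<rho>\<close> and merge there as \<open>q\<close> tends to 1, where \<open>C q\<close> tends to the threshold.\<close>

lemma leading_coefficient_bound:
  fixes n c :: "nat \<Rightarrow> real"
  assumes N: "N > 0" and inj: "inj_on n {..<N}" and M: "\<And>j. j < N \<Longrightarrow> n j < M" and \<rho>: "\<rho> > 0"
    and c: "\<And>j. j < N \<Longrightarrow> c j > 0"
    and pos: "\<And>u v. (\<And>i. i < N \<Longrightarrow> 0 < u i \<and> u i < sqrt \<rho>) \<Longrightarrow>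
      0 \<le> (\<Sum>j<N. c j * (\<Sum>i<N. v i * u i powr n j)\<^sup>2) + c' * (\<Sum>i<N. v i * u i powr M)\<^sup>2"
  shows "c' \<ge> - inverse (threshold N n M \<rho> c)"
proof -
  define a where "a q j = (sqrt \<rho> * q) powr (M - n j) * lagrange_basis {..<N} (\<lambda>i. q powr n i) (q powr M) j" for q j
  define C where "C q = (\<Sum>j<N. (a q j)\<^sup>2 / c j)" for q
  have ineq: "0 \<le> C q + c' * (C q)\<^sup>2" if q: "0 < q" "q < 1" for q
  proof -
    have "0 \<le> (\<Sum>j<N. c j * (a q j / c j)\<^sup>2) + c' * (\<Sum>j<N. a q j * (a q j / c j))\<^sup>2"
      unfolding a_def using q \<rho> by (intro form_at_geometric_nodes[OF inj _ _ _ _ pos]) auto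
    moreover have "(\<Sum>j<N. c j * (a q j / c j)\<^sup>2) = C q" "(\<Sum>j<N. a q j * (a q j / c j)) = C q"
      unfolding C_def using c by (auto intro!: sum.cong simp: power2_eq_square less_imp_neq[symmetric])
    ultimately show ?thesis by simp
  qed
  have a_lim: "((\<lambda>q. a q j) \<longlongrightarrow> sqrt \<rho> powr (M - n j) * lagrange_basis {..<N} n M j) (at_left 1)"
    if "j < N" for j
  proof -
    have "((\<lambda>q. (sqrt \<rho> * q) powr (M - n j)) \<longlongrightarrow> (sqrt \<rho> * 1) powr (M - n j)) (at_left 1)"
      using \<rho> by (intro tendsto_intros) auto
    moreover have "((\<lambda>q. lagrange_basis {..<N} (\<lambda>i. q powr n i) (q powr M) j)
        \<longlongrightarrow> lagrange_basis {..<N} n M j) (at_left 1)"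
      using that by (intro lagrange_basis_powr_tendsto inj) auto
    ultimately show ?thesis
      unfolding a_def by (auto dest: tendsto_mult)
  qed
  define T where "T = threshold N n M \<rho> c"
  have T: "T > 0" unfolding T_def by (rule threshold_pos[OF N inj M \<rho> c])
  have "(C \<longlongrightarrow> T) (at_left 1)"
    unfolding C_def T_def threshold_eq[OF inj \<rho>]
    using c by (intro tendsto_sum tendsto_divide tendsto_power a_lim tendsto_const) (auto simp: less_imp_neq[symmetric])
  from tendsto_add[OF this tendsto_mult[OF tendsto_const tendsto_power[OF this]]]
  have "((\<lambda>q. C q + c' * (C q)\<^sup>2) \<longlongrightarrow> T + c' * T\<^sup>2) (at_left 1)" .
  moreover have "\<forall>\<^sub>F q in at_left (1::real). 0 \<le> C q + c' * (C q)\<^sup>2"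
    using ineq by (intro eventually_at_leftI[of 0]) auto
  ultimately have "0 \<le> T + c' * T\<^sup>2"
    by (rule tendsto_lowerbound) simp
  then have "0 \<le> T * (1 + c' * T)" by (simp add: power2_eq_square algebra_simps)
  then have "0 \<le> 1 + c' * T" using T by (simp add: zero_le_mult_iff)
  then show ?thesis using T unfolding T_def[symmetric] by (simp add: field_simps)
qed

section \<open>The characterization\<close>

theorem theorem1p11:
  fixes N :: nat and n :: "nat \<Rightarrow> real" and M \<rho> :: real
    and c :: "nat \<Rightarrow> real" and c' :: real and f :: "real \<Rightarrow> real"
  assumes "N > 0"
    and "strict_mono_on {..<N} n" and "n (N - 1) < M"
    and "\<rho> > 0"
    and "f = (\<lambda>x. (\<Sum>j<N. c j * x powr n j) + c' * x powr M)"
  shows "preserves_positivity_on N f {A \<in> psd_mats N {0<..<\<rho>}. mat_rank N A = 1} \<longleftrightarrow>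
    ((\<forall>j<N. c j \<ge> 0) \<and> c' \<ge> 0) \<or>
    ((\<forall>j<N. c j > 0) \<and> c' \<ge> - inverse (threshold N n M \<rho> c))"
proof -
  note N = assms(1) and \<rho> = assms(4)
  have inj: "inj_on n {..<N}" using assms(2) by (rule strict_mono_on_imp_inj_on)
  have M: "n j < M" if "j < N" for j
  proof -
    have "n j \<le> n (N - 1)"
      using strict_mono_on_leD[OF assms(2), of j "N - 1"] that by simp
    then show ?thesis using assms(3) by simp
  qed
  define F where "F u v = (\<Sum>j<N. c j * (\<Sum>i<N. v i * u i powr n j)\<^sup>2) + c' * (\<Sum>i<N. v i * u i powr M)\<^sup>2"
    for u v :: "nat \<Rightarrow> real"
  have "(\<forall>u v. (\<forall>i<N. 0 < u i \<and> u i < sqrt \<rho>) \<longrightarrow> 0 \<le> F u v) \<longleftrightarrow>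
    ((\<forall>j<N. c j \<ge> 0) \<and> c' \<ge> 0) \<or>
    ((\<forall>j<N. c j > 0) \<and> c' \<ge> - inverse (threshold N n M \<rho> c))" (is "?pos \<longleftrightarrow> ?plain \<or> ?sharp")
  proof
    assume ?pos
    then have pos: "0 \<le> (\<Sum>j<N. c j * (\<Sum>i<N. v i * u i powr n j)\<^sup>2) + c' * (\<Sum>i<N. v i * u i powr M)\<^sup>2"
      if "\<And>i. i < N \<Longrightarrow> 0 < u i \<and> u i < sqrt \<rho>" for u v
      using that by (simp add: F_def)
    show "?plain \<or> ?sharp"
    proof (cases "c' \<ge> 0")
      case True
      then show ?thesis using coefficients_nonneg(1)[OF inj M \<rho> _ pos] by blast
    next
      case False
      then have "c j > 0" if "j < N" for j
        using coefficients_nonneg(2)[OF inj M \<rho> that pos] by simp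
      then show ?thesis using leading_coefficient_bound[OF N inj M \<rho> _ pos] by blast
    qed
  next
    assume "?plain \<or> ?sharp"
    then show ?pos
    proof
      assume ?plain
      then show ?pos by (auto simp: F_def intro!: add_nonneg_nonneg sum_nonneg)
    next
      assume ?sharp
      then show ?pos
        unfolding F_def
        by (intro allI impI form_nonneg_above_threshold[OF inj M \<rho> _ N]) (auto intro: less_imp_le)
    qed
  qed
  then show ?thesis
    unfolding preserves_positivity_on_rank_one_iff[OF N assms(5)] F_def .
qed

end
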